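(* Let $\mathcal{E}$ be a set of axioms and let $\mathcal{G}$, $\mathcal{G}'$ be substitution graphs with the same number of input nodes. If $\mathcal{G}\overset{\mathcal{E}}{\sim}\mathcal{G}'$ (i.e. $[\mathcal{G}]\overset{\mathcal{E}}{\sim}[\mathcal{G}']$), then $\mathcal{G}$ and $\mathcal{G}'$ are connected by a finite sequence of layer collapses, layer expansions, and node rewrites by $\mathcal{E}$.
   Context: **Formulae.** A Łukasiewicz formula is a finite string built from propositional variables $x_1,x_2,\dots$ and constants $0,1$ with binary connectives $\oplus,\odot$ and unary $\lnot$. A substitution $\zeta=\{x_{i_1}\mapsto\chi_1,\dots,x_{i_k}\mapsto\chi_k\}$ applied to $\tau$ gives $\tau(\zeta)$, obtained by simultaneously replacing every occurrence of each $x_{i_j}$ by $\chi_j$. **Derivation.** An axiom $e$ is an equation $\epsilon=\epsilon'$ between formulae. Write $\tau\overset{e}{\sim}\tau'$ if $\tau'$ arises from $\tau$ by replacing one occurrence of a subformula $\gamma$ by $\gamma'$ where, for some substitution $\zeta$, $(\gamma,\gamma')=(\epsilon(\zeta),\epsilon'(\zeta))$ or $(\gamma,\gamma')=(\epsilon'(\zeta),\epsilon(\zeta))$. For a set $\mathcal{E}$ of axioms, $\tau\overset{\mathcal{E}}{\sim}\tau'$ means there is a finite sequence $\tau=\tau_1,\dots,\tau_T=\tau'$ ($T\ge1$) with $\tau_t\overset{e_t}{\sim}\tau_{t+1}$, $e_t\in\mathcal{E}$. **Substitution graphs.** A layered graph of depth $L\ge1$ has levels $V^{(j)}=\{v^{(j)}_1,\dots,v^{(j)}_{d_j}\}$,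 $d_j\ge1$, $j=0,\dots,L$, $d_L=1$, $V^{(L)}=\{v_{\rm out}\}$, with edges exactly all pairs of nodes in consecutive levels. A substitution graph $\mathcal{G}$ is a layered graph with a formula $[v]$ at each node: input nodes carry $[v_i^{(0)}]=x_i$, and a level-$j$ node, $j\ge1$, carries a formula in the variables $x_1,\dots,x_{d_{j-1}}$ (the "level-$(j-1)$ variables"), $x_{i'}$ referring to the parent $v_{i'}^{(j-1)}$. Layer substitutions: $\zeta^{(j-1,j)}=\{x_{i'}\mapsto[v_{i'}^{(j-1)}]:i'=1,\dots,d_{j-1}\}$. The represented formula is $[\mathcal{G}]=[v_{\rm out}](\zeta^{(L-1,L)})(\zeta^{(L-2,L-1)})\cdots(\zeta^{(0,1)})$ (applied successively from left to right). **Node rewrite by $\mathcal{E}$.** Replace the formula $[v]$ of one non-input node $v$ at level $j$ by a formula $\tau'$ in the variables $x_1,\dots,x_{d_{j-1}}$ with $[v]\overset{e}{\sim}\tau'$ for some $e\in\mathcal{E}$, leaving everything else unchanged. **Layer collapse.** For $L\ge2$ and $k\in\{1,\dots,L-1\}$: remove the level-$k$ nodes, join levels $k-1$ and $k+1$, and replace the formula $[v]$ of every level-$(k+1)$ node by $[v](\zeta^{(k,k+1)})$. **Layer expansion.** For $k\in\{1,\dots,L\}$: insert a new level of $m\ge1$ nodes between levels $k-1$ and $k$ (shifting levels $\ge k$ up by one); the inserted nodes carry formulae $\chi_1,\dots,\chi_m$ in the level-$(k-1)$ variables, and the formula $[v]$ of every node now at level $k+1$ is replaced by a formula $[v]'$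 in $x_1,\dots,x_m$ with $[v]'(\{x_1\mapsto\chi_1,\dots,x_m\mapsto\chi_m\})=[v]$ (equality of strings); $m$, the $\chi_i$ and the $[v]'$ are free choices subject to this. *)

theory Defs
  imports Main
begin

text \<open>
  Formulae are represented by their syntax trees, so equality of strings is equality of terms.
  Variables and nodes are numbered from 0: \<open>Var i\<close> stands for $x_{i+1}$.
\<close>

datatype formula =
    Var nat
  | Zero
  | One
  | Oplus formula formula
  | Odot formula formula
  | Neg formula

primrec vars :: "formula \<Rightarrow> nat set" where
  "vars (Var i) = {i}"
| "vars Zero = {}"
| "vars One = {}"
| "vars (Oplus a b) = vars a \<union> vars b"
| "vars (Odot a b) = vars a \<union> vars b"
| "vars (Neg a) = vars a"

type_synonym substitution = "nat \<rightharpoonup> formula"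

primrec subst_formula :: "substitution \<Rightarrow> formula \<Rightarrow> formula" where
  "subst_formula \<zeta> (Var i) = (case \<zeta> i of None \<Rightarrow> Var i | Some \<chi> \<Rightarrow> \<chi>)"
| "subst_formula \<zeta> Zero = Zero"
| "subst_formula \<zeta> One = One"
| "subst_formula \<zeta> (Oplus a b) = Oplus (subst_formula \<zeta> a) (subst_formula \<zeta> b)"
| "subst_formula \<zeta> (Odot a b) = Odot (subst_formula \<zeta> a) (subst_formula \<zeta> b)"
| "subst_formula \<zeta> (Neg a) = Neg (subst_formula \<zeta> a)"

text \<open>An axiom is an equation, given as the pair of its two sides.\<close>

type_synonym equation = "formula \<times> formula"

text \<open>\<open>replace_one \<gamma> \<gamma>' \<tau> \<tau>'\<close>: \<open>\<tau>'\<close> arises from \<open>\<tau>\<close> by replacing exactly one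
  occurrence of the subformula \<open>\<gamma>\<close> by \<open>\<gamma>'\<close>.\<close>

inductive replace_one :: "formula \<Rightarrow> formula \<Rightarrow> formula \<Rightarrow> formula \<Rightarrow> bool" for \<gamma> \<gamma>' where
  here: "replace_one \<gamma> \<gamma>' \<gamma> \<gamma>'"
| oplus_left: "replace_one \<gamma> \<gamma>' a a' \<Longrightarrow> replace_one \<gamma> \<gamma>' (Oplus a b) (Oplus a' b)"
| oplus_right: "replace_one \<gamma> \<gamma>' b b' \<Longrightarrow> replace_one \<gamma> \<gamma>' (Oplus a b) (Oplus a b')"
| odot_left: "replace_one \<gamma> \<gamma>' a a' \<Longrightarrow> replace_one \<gamma> \<gamma>' (Odot a b) (Odot a' b)"
| odot_right: "replace_one \<gamma> \<gamma>' b b' \<Longrightarrow> replace_one \<gamma> \<gamma>' (Odot a b) (Odot a b')"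
| neg: "replace_one \<gamma> \<gamma>' a a' \<Longrightarrow> replace_one \<gamma> \<gamma>' (Neg a) (Neg a')"

definition axiom_step :: "equation \<Rightarrow> formula \<Rightarrow> formula \<Rightarrow> bool" where
  "axiom_step e \<tau> \<tau>' \<longleftrightarrow>
     (\<exists>\<gamma> \<gamma>' \<zeta>. finite (dom \<zeta>) \<and>
        ((\<gamma>, \<gamma>') = (subst_formula \<zeta> (fst e), subst_formula \<zeta> (snd e)) \<or>
         (\<gamma>, \<gamma>') = (subst_formula \<zeta> (snd e), subst_formula \<zeta> (fst e))) \<and>
        replace_one \<gamma> \<gamma>' \<tau> \<tau>')"

definition derivable :: "equation set \<Rightarrow> formula \<Rightarrow> formula \<Rightarrow> bool" where
  "derivable E = (\<lambda>\<tau> \<tau>'. \<exists>e\<in>E. axiom_step e \<tau> \<tau>')\<^sup>*\<^sup>*"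

text \<open>
  A layered graph is determined by its level sizes, since consecutive levels are completely
  connected. A graph with formulae at its nodes is therefore given by the list of its levels
  \<open>0, \<dots>, L\<close>, each level being the list of the formulae at its nodes: \<open>G ! j ! i\<close> is the formula
  $[v_{i+1}^{(j)}]$, and the length of \<open>G ! j\<close> is $d_j$.
\<close>

type_synonym levels = "formula list list"

definition depth :: "levels \<Rightarrow> nat" where
  "depth G = length G - 1"

definition substitution_graph :: "levels \<Rightarrow> bool" where
  "substitution_graph G \<longleftrightarrow>
     depth G \<ge> 1 \<and>
     (\<forall>j\<le>depth G. length (G ! j) \<ge> 1) \<and>
     length (G ! depth G) = 1 \<and>
     (\<forall>i<length (G ! 0). G ! 0 ! i = Var i) \<and>
     (\<forall>j\<in>{1..depth G}. \<forall>i<length (G ! j). vars (G ! j ! i) \<subseteq> {..<length (G ! (j - 1))})"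

text \<open>The substitution $\{x_1 \mapsto \chi_1, \dots, x_m \mapsto \chi_m\}$ given by a list
  $\chi_1, \dots, \chi_m$; applied to level $j-1$ of a graph it is $\zeta^{(j-1,j)}$.\<close>

definition level_subst :: "formula list \<Rightarrow> substitution" where
  "level_subst \<chi>s = (\<lambda>i. if i < length \<chi>s then Some (\<chi>s ! i) else None)"

text \<open>The right fold applies $\zeta^{(L-1,L)}$ first and $\zeta^{(0,1)}$ last.\<close>

definition represented :: "levels \<Rightarrow> formula" where
  "represented G =
     foldr (\<lambda>j. subst_formula (level_subst (G ! j))) [0..<depth G] (G ! depth G ! 0)"

definition graph_equiv :: "equation set \<Rightarrow> levels \<Rightarrow> levels \<Rightarrow> bool" where
  "graph_equiv E G G' \<longleftrightarrow> derivable E (represented G) (represented G')"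

definition node_rewrite :: "equation set \<Rightarrow> levels \<Rightarrow> levels \<Rightarrow> bool" where
  "node_rewrite E G G' \<longleftrightarrow>
     (\<exists>j\<in>{1..depth G}. \<exists>i<length (G ! j). \<exists>\<tau>'.
        vars \<tau>' \<subseteq> {..<length (G ! (j - 1))} \<and>
        (\<exists>e\<in>E. axiom_step e (G ! j ! i) \<tau>') \<and>
        G' = G[j := (G ! j)[i := \<tau>']])"

text \<open>For depth 1 the index set is empty, so no collapse applies.\<close>

definition layer_collapse :: "levels \<Rightarrow> levels \<Rightarrow> bool" where
  "layer_collapse G G' \<longleftrightarrow>
     (\<exists>k\<in>{1..depth G - 1}.
        G' = take k G
               @ map (subst_formula (level_subst (G ! k))) (G ! (k + 1))
               # drop (k + 2) G)"

text \<open>Here \<open>\<chi>s\<close> is the inserted level, and \<open>vs\<close> lists the new formulae $[v]'$ of the nodes that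
  move from level \<open>k\<close> to level \<open>k + 1\<close>.\<close>

definition layer_expansion :: "levels \<Rightarrow> levels \<Rightarrow> bool" where
  "layer_expansion G G' \<longleftrightarrow>
     (\<exists>k\<in>{1..depth G}. \<exists>\<chi>s vs.
        length \<chi>s \<ge> 1 \<and>
        (\<forall>\<chi>\<in>set \<chi>s. vars \<chi> \<subseteq> {..<length (G ! (k - 1))}) \<and>
        (\<forall>v\<in>set vs. vars v \<subseteq> {..<length \<chi>s}) \<and>
        map (subst_formula (level_subst \<chi>s)) vs = G ! k \<and>
        G' = take k G @ \<chi>s # vs # drop (k + 1) G)"

text \<open>The condition on \<open>G'\<close> is implied by the others; it is stated to make explicit that all
  intermediate objects are substitution graphs.\<close>

definition graph_step :: "equation set \<Rightarrow> levels \<Rightarrow> levels \<Rightarrow> bool" where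
  "graph_step E G G' \<longleftrightarrow>
     substitution_graph G \<and> substitution_graph G' \<and>
     (layer_collapse G G' \<or> layer_expansion G G' \<or> node_rewrite E G G')"

end

(* Collapsing repeatedly at the output brings every graph to a depth-one graph carrying the
   represented formula, and expansions undo these collapses. It remains to perform the derivation
   by node rewrites on depth-one graphs. Its intermediate formulae may contain variables that are
   not inputs; replacing these throughout by 0 keeps it a derivation between the same formulae. *)

theory Submission
  imports Defs
begin

lemma subst_formula_id:
  assumes "\<And>i. i \<in> vars \<tau> \<Longrightarrow> subst_formula \<zeta> (Var i) = Var i"
  shows "subst_formula \<zeta> \<tau> = \<tau>"
  using assms by (induction \<tau>) auto

lemma vars_subst_formula:
  "vars (subst_formula \<zeta> \<tau>) = (\<Union>i\<in>vars \<tau>. vars (subst_formula \<zeta> (Var i)))"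
  by (induction \<tau>) auto

lemma finite_vars: "finite (vars \<tau>)"
  by (induction \<tau>) auto

text \<open>The composite is restricted to \<open>A\<close> because \<sigma> may have an infinite
  domain, whereas \<open>axiom_step\<close> asks for a finite one.\<close>

lemma subst_formula_compose:
  assumes "vars \<tau> \<subseteq> A"
  shows "subst_formula \<sigma> (subst_formula \<zeta> \<tau>) =
    subst_formula ((\<lambda>i. Some (subst_formula \<sigma> (subst_formula \<zeta> (Var i)))) |` A) \<tau>"
  using assms by (induction \<tau>) auto

lemma replace_one_subst:
  assumes "replace_one \<gamma> \<gamma>' \<tau> \<tau>'"
  shows "replace_one (subst_formula \<sigma> \<gamma>) (subst_formula \<sigma> \<gamma>')
    (subst_formula \<sigma> \<tau>) (subst_formula \<sigma> \<tau>')"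
  using assms by induction (auto intro: replace_one.intros)

text \<open>Substituting into an instance of an axiom gives an instance again, by the composed
  substitution, and the replaced occurrence keeps its position.\<close>

lemma axiom_step_subst:
  assumes "axiom_step e \<tau> \<tau>'"
  shows "axiom_step e (subst_formula \<sigma> \<tau>) (subst_formula \<sigma> \<tau>')"
proof -
  from assms obtain \<gamma> \<gamma>' \<zeta> where
    eq: "(\<gamma>, \<gamma>') = (subst_formula \<zeta> (fst e), subst_formula \<zeta> (snd e)) \<or>
         (\<gamma>, \<gamma>') = (subst_formula \<zeta> (snd e), subst_formula \<zeta> (fst e))"
    and r: "replace_one \<gamma> \<gamma>' \<tau> \<tau>'"
    unfolding axiom_step_def by blast
  \<comment> \<open>One substitution must produce both sides of the axiom, so its finite domain has
    to cover the variables of both.\<close>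
  define A where "A = vars (fst e) \<union> vars (snd e)"
  define \<eta> where "\<eta> = (\<lambda>i. Some (subst_formula \<sigma> (subst_formula \<zeta> (Var i)))) |` A"
  have "finite (dom \<eta>)"
    by (auto simp: \<eta>_def A_def finite_vars dom_def restrict_map_def)
  moreover have "subst_formula \<sigma> (subst_formula \<zeta> (fst e)) = subst_formula \<eta> (fst e)"
    "subst_formula \<sigma> (subst_formula \<zeta> (snd e)) = subst_formula \<eta> (snd e)"
    unfolding \<eta>_def by (rule subst_formula_compose, simp add: A_def)+
  ultimately show ?thesis
    using eq replace_one_subst[OF r, of \<sigma>] unfolding axiom_step_def by fastforce
qed

text \<open>One substitution applied to every formula of the derivation fixes the two ends and
  confines everything between them to \<open>A\<close>. Node rewrites on depth-one graphs need this
  bound, with the inputs as \<open>A\<close>.\<close>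

lemma derivable_within_vars:
  assumes "derivable E \<tau> \<tau>'" "vars \<tau> \<subseteq> A" "vars \<tau>' \<subseteq> A"
  shows "(\<lambda>\<phi> \<psi>. vars \<phi> \<subseteq> A \<and> vars \<psi> \<subseteq> A \<and> (\<exists>e\<in>E. axiom_step e \<phi> \<psi>))\<^sup>*\<^sup>* \<tau> \<tau>'"
    (is "?R\<^sup>*\<^sup>* _ _")
proof -
  \<comment> \<open>The domain, the complement of \<open>A\<close>, may be infinite;
    \<open>axiom_step_subst\<close> allows an arbitrary \<sigma>.\<close>
  let ?\<sigma> = "subst_formula (\<lambda>i. if i \<in> A then None else Some Zero)"
  have vars_\<sigma>: "vars (?\<sigma> \<phi>) \<subseteq> A" for \<phi>
    by (subst vars_subst_formula) (auto split: if_splits)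
  have "?R\<^sup>*\<^sup>* (?\<sigma> \<tau>) (?\<sigma> \<tau>')"
    using assms(1) unfolding derivable_def
  proof induction
    case (step \<phi> \<psi>)
    then have "?R (?\<sigma> \<phi>) (?\<sigma> \<psi>)"
      using vars_\<sigma> axiom_step_subst by blast
    with step.IH show ?case by (rule rtranclp.rtrancl_into_rtrancl)
  qed simp
  moreover have "?\<sigma> \<phi> = \<phi>" if "vars \<phi> \<subseteq> A" for \<phi>
    by (rule subst_formula_id) (use that in auto)
  ultimately show ?thesis using assms(2,3) by simp
qed

definition flat_graph :: "nat \<Rightarrow> formula \<Rightarrow> levels" where
  "flat_graph d \<tau> = [map Var [0..<d], [\<tau>]]"

lemma substitution_graph_flat:
  "substitution_graph (flat_graph d \<tau>) \<longleftrightarrow> d \<ge> 1 \<and> vars \<tau> \<subseteq> {..<d}"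
  by (auto simp: substitution_graph_def depth_def flat_graph_def le_Suc_eq)

lemma represented_flat:
  assumes "vars \<tau> \<subseteq> {..<d}"
  shows "represented (flat_graph d \<tau>) = \<tau>"
proof -
  have "subst_formula (level_subst (map Var [0..<d])) \<tau> = \<tau>"
    by (rule subst_formula_id) (use assms in \<open>auto simp: level_subst_def\<close>)
  then show ?thesis by (simp add: represented_def depth_def flat_graph_def)
qed

text \<open>The collapsed output stays within its new parents: variables of \<open>z\<close> name
  nodes of \<open>Y\<close>, whose formulae use only the last level of \<open>pre\<close>. As
  \<open>pre\<close> is nonempty, the input level survives.\<close>

lemma substitution_graph_collapse_top:
  assumes "substitution_graph (pre @ [Y, [z]])" "pre \<noteq> []"
  shows "substitution_graph (pre @ [[subst_formula (level_subst Y) z]])"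
proof -
  let ?n = "length pre"
  have len: "length ((pre @ [Y, [z]]) ! j) \<ge> 1" if "j \<le> ?n + 1" for j
    using assms that by (auto simp: substitution_graph_def depth_def)
  have vars: "vars ((pre @ [Y, [z]]) ! j ! i) \<subseteq> {..<length ((pre @ [Y, [z]]) ! (j - 1))}"
    if "1 \<le> j" "j \<le> ?n + 1" "i < length ((pre @ [Y, [z]]) ! j)" for i j
    using assms that by (auto simp: substitution_graph_def depth_def)
  have n: "?n > 0" using assms(2) by simp
  have Y: "vars (Y ! i) \<subseteq> {..<length (pre ! (?n - 1))}" if "i < length Y" for i
    using vars[of ?n i] n that by (simp add: nth_append)
  have "vars z \<subseteq> {..<length Y}"
    using vars[of "?n + 1" 0] by (simp add: nth_append)
  with Y have z: "vars (subst_formula (level_subst Y) z) \<subseteq> {..<length (pre ! (?n - 1))}"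
    by (subst vars_subst_formula) (fastforce simp: level_subst_def)
  have "length ((pre @ [[subst_formula (level_subst Y) z]]) ! j) \<ge> 1" if "j \<le> ?n" for j
    using len[of j] that by (auto simp: nth_append)
  moreover have "vars ((pre @ [[subst_formula (level_subst Y) z]]) ! j ! i)
      \<subseteq> {..<length ((pre @ [[subst_formula (level_subst Y) z]]) ! (j - 1))}"
    if "1 \<le> j" "j \<le> ?n" "i < length ((pre @ [[subst_formula (level_subst Y) z]]) ! j)" for i j
  proof (cases "j = ?n")
    case True
    with that n z show ?thesis by (simp add: nth_append)
  next
    case False
    \<comment> \<open>Levels \<open>j\<close> and \<open>j - 1\<close> both lie in
      \<open>pre\<close>, which the collapse leaves alone.\<close>
    with that have "j < ?n" "j - 1 < ?n" by auto
    with that vars[of j i] show ?thesis by (simp add: nth_append)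
  qed
  moreover have "\<forall>i<length (pre ! 0). pre ! 0 ! i = Var i"
    using assms n by (simp add: substitution_graph_def nth_append)
  then have "\<forall>i<length ((pre @ [[subst_formula (level_subst Y) z]]) ! 0).
      (pre @ [[subst_formula (level_subst Y) z]]) ! 0 ! i = Var i"
    using n by (simp add: nth_append)
  moreover have "depth (pre @ [[subst_formula (level_subst Y) z]]) = ?n"
    by (simp add: depth_def)
  moreover have "length ((pre @ [[subst_formula (level_subst Y) z]]) ! ?n) = 1"
    by simp
  ultimately show ?thesis
    using n unfolding substitution_graph_def by (metis Suc_le_eq One_nat_def atLeastAtMost_iff)
qed

text \<open>The collapsed level is \<open>k = length pre\<close>; level \<open>k + 1\<close> is the
  output level, so nothing follows it.\<close>

lemma layer_collapse_top:
  assumes "pre \<noteq> []"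
  shows "layer_collapse (pre @ [Y, [z]]) (pre @ [[subst_formula (level_subst Y) z]])"
  unfolding layer_collapse_def using assms
  by (intro bexI[of _ "length pre"]) (auto simp: depth_def nth_append Suc_le_eq)

text \<open>An expansion chooses its inserted level and new formulae freely, so \<open>Y\<close> and
  \<open>[z]\<close> recover exactly what the collapse at the output removed.\<close>

lemma layer_expansion_top:
  assumes "substitution_graph (pre @ [Y, [z]])" "pre \<noteq> []"
  shows "layer_expansion (pre @ [[subst_formula (level_subst Y) z]]) (pre @ [Y, [z]])"
proof -
  let ?n = "length pre"
  let ?G = "pre @ [Y, [z]]"
  have n: "?n > 0" using assms(2) by simp
  have vars: "vars (?G ! j ! i) \<subseteq> {..<length (?G ! (j - 1))}"
    if "1 \<le> j" "j \<le> ?n + 1" "i < length (?G ! j)" for i j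
    using assms that by (auto simp: substitution_graph_def depth_def)
  have "\<forall>j\<le>?n + 1. length (?G ! j) \<ge> 1"
    using assms by (auto simp: substitution_graph_def depth_def)
  from this[rule_format, of ?n] have "length Y \<ge> 1" by (simp add: nth_append)
  moreover have "vars (Y ! i) \<subseteq> {..<length (pre ! (?n - 1))}" if "i < length Y" for i
    using vars[of ?n i] n that by (simp add: nth_append)
  then have "\<forall>\<chi>\<in>set Y. vars \<chi> \<subseteq> {..<length (pre ! (?n - 1))}"
    by (metis in_set_conv_nth)
  moreover have "vars z \<subseteq> {..<length Y}"
    using vars[of "?n + 1" 0] by (simp add: nth_append)
  ultimately show ?thesis
    unfolding layer_expansion_def using n
    by (intro bexI[of _ ?n] exI[of _ Y] exI[of _ "[z]"])
      (simp_all add: depth_def nth_append Suc_le_eq)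
qed

text \<open>The output formula has absorbed the substitution by \<open>Y\<close>, the first one that
  the fold for the larger graph applies; the remaining levels agree.\<close>

lemma represented_collapse_top:
  "represented (pre @ [[subst_formula (level_subst Y) z]]) = represented (pre @ [Y, [z]])"
  by (auto simp: represented_def depth_def nth_append intro!: foldr_cong)

text \<open>Induction on the number of levels, collapsing the level next to the output. Both
  directions are carried along, since one graph has to be flattened and the other rebuilt.\<close>

lemma substitution_graph_flatten:
  assumes "substitution_graph G"
  shows "vars (represented G) \<subseteq> {..<length (G ! 0)} \<and>
    (graph_step E)\<^sup>*\<^sup>* G (flat_graph (length (G ! 0)) (represented G)) \<and>
    (graph_step E)\<^sup>*\<^sup>* (flat_graph (length (G ! 0)) (represented G)) G"
  using assms
proof (induction "length G" arbitrary: G rule: less_induct)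
  case less
  have len: "length G \<ge> 2" and last: "length (G ! (length G - 1)) = 1"
    using less.prems by (auto simp: substitution_graph_def depth_def)
  define pre where "pre = take (length G - 2) G"
  obtain Y Z where G: "G = pre @ [Y, Z]"
  proof
    have "drop (length G - 2) G = [G ! (length G - 2), G ! (length G - 1)]"
      using len by (intro nth_equalityI) (auto simp: nth_Cons less_Suc_eq split: nat.split)
    then show "G = pre @ [G ! (length G - 2), G ! (length G - 1)]"
      unfolding pre_def by (metis append_take_drop_id)
  qed
  then obtain z where Z: "Z = [z]"
    using last by (auto simp: nth_append length_Suc_conv)
  show ?case
  proof (cases "pre = []")
    \<comment> \<open>Depth one: the input level is forced to be the list of variables, so the graph
      is already flat.\<close>
    case True
    have "G ! 0 = map Var [0..<length (G ! 0)]"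
      using less.prems by (intro nth_equalityI) (auto simp: substitution_graph_def)
    with True G Z have flat: "G = flat_graph (length (G ! 0)) z"
      by (simp add: flat_graph_def)
    with less.prems have z: "vars z \<subseteq> {..<length (G ! 0)}"
      using substitution_graph_flat[of "length (G ! 0)" z] by argo
    with flat have "represented G = z"
      using represented_flat[OF z] by argo
    with flat z show ?thesis by auto
  next
    case False
    define H where "H = pre @ [[subst_formula (level_subst Y) z]]"
    have G': "G = pre @ [Y, [z]]" using G Z by simp
    have H: "substitution_graph H"
      unfolding H_def using substitution_graph_collapse_top less.prems False G' by blast
    have "graph_step E G H" "graph_step E H G"
      using less.prems H layer_collapse_top[OF False] layer_expansion_top[OF _ False]
      unfolding graph_step_def G' H_def by blast+
    \<comment> \<open>\<open>H\<close> keeps the inputs and the represented formula, hence flattens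
      to the same graph as \<open>G\<close>.\<close>
    moreover have "length H < length G" "H ! 0 = G ! 0" "represented H = represented G"
      using False by (simp_all add: H_def G' represented_collapse_top nth_append)
    ultimately show ?thesis
      using less.hyps[of H] H
      by (metis converse_rtranclp_into_rtranclp rtranclp.rtrancl_into_rtrancl)
  qed
qed

text \<open>The parents of the output are the inputs themselves, so a step between formulae in the
  input variables is a rewrite of the node at level 1, position 0.\<close>

lemma graph_step_flat:
  assumes "d \<ge> 1" "vars \<tau> \<subseteq> {..<d}" "vars \<tau>' \<subseteq> {..<d}" "e \<in> E" "axiom_step e \<tau> \<tau>'"
  shows "graph_step E (flat_graph d \<tau>) (flat_graph d \<tau>')"
proof -
  have "node_rewrite E (flat_graph d \<tau>) (flat_graph d \<tau>')"
    unfolding node_rewrite_def using assms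
    by (intro bexI[of _ 1] exI[of _ 0] exI[of _ \<tau>']) (auto simp: flat_graph_def depth_def)
  with assms show ?thesis by (simp add: graph_step_def substitution_graph_flat)
qed

theorem proposition4:
  fixes E :: "equation set" and G G' :: levels
  assumes "substitution_graph G" and "substitution_graph G'"
    and "length (G ! 0) = length (G' ! 0)"
    and "graph_equiv E G G'"
  shows "(graph_step E)\<^sup>*\<^sup>* G G'"
proof -
  let ?d = "length (G ! 0)"
  note G = substitution_graph_flatten[OF assms(1), of E]
  \<comment> \<open>Equal numbers of inputs give both flat graphs the same input level.\<close>
  note G' = substitution_graph_flatten[OF assms(2), of E, folded assms(3)]
  have d: "?d \<ge> 1"
    using assms(1) by (auto simp: substitution_graph_def)
  have "(\<lambda>\<phi> \<psi>. vars \<phi> \<subseteq> {..<?d} \<and> vars \<psi> \<subseteq> {..<?d} \<and> (\<exists>e\<in>E. axiom_step e \<phi> \<psi>))\<^sup>*\<^sup>*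
      (represented G) (represented G')"
    using assms(4) G G' by (intro derivable_within_vars) (auto simp: graph_equiv_def)
  then have "(graph_step E)\<^sup>*\<^sup>* (flat_graph ?d (represented G)) (flat_graph ?d (represented G'))"
  proof induction
    case (step \<phi> \<psi>)
    then have "graph_step E (flat_graph ?d \<phi>) (flat_graph ?d \<psi>)"
      using graph_step_flat[OF d] by blast
    with step.IH show ?case by (rule rtranclp.rtrancl_into_rtrancl)
  qed simp
  \<comment> \<open>Flatten \<open>G\<close>, run the derivation at the output, then rebuild
    \<open>G'\<close>.\<close>
  with G G' show ?thesis by (meson rtranclp_trans)
qed

end
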